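(* Let $K,L$ be topological fields, and let $X$ and $Y$ be vector spaces over $K$ and $L$, respectively, with $\dim_K(X)\geq 3$. If there exists a lattice isomorphism $\Phi:\tau_K(X)\rightarrow\tau_L(Y)$ such that $\Phi(\tau_K^H(X))=\tau_L^H(Y)$, then $K$ and $L$ are isomorphic as fields (not necessarily as topological fields), and the vector spaces $X$ and $Y$ have the same dimension, i.e. $\dim_K X=\dim_L Y$.
   Context: A topological field is a field $K$ endowed with a Hausdorff topology such that addition, multiplication, and inversion on $K\setminus\{0\}$ are continuous. A vector topology on a vector space $X$ over a topological field $K$ is a (not necessarily Hausdorff) topology on $X$ for which addition $X\times X\to X$ and scalar multiplication $K\times X\to X$ are continuous (product topologies). $\tau_K(X)$ is the set of all vector topologies on $X$ (each viewed as its family of open sets), ordered by inclusion; it is a complete lattice. $\tau_K^H(X)\subset\tau_K(X)$ is the subset of Hausdorff vector topologies. Similarly $\tau_L(Y)$, $\tau_L^H(Y)$. Vector spaces may be infinite-dimensional. A lattice isomorphism is a bijection preserving joins and meets (equivalently, a bijection which, together with its inverse, preserves the order). *)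

theory Defs
  imports "HOL-Analysis.Analysis" "HOL-Algebra.Complete_Lattice"
begin

unbundle cardinal_syntax

text \<open>Field and vector space structures live on whole types, so each topology is required to
  have \<^term>\<open>UNIV\<close> as its underlying set.\<close>

definition topological_field :: "'k::field topology \<Rightarrow> bool" where
  "topological_field TK \<longleftrightarrow>
     topspace TK = UNIV \<and>
     Hausdorff_space TK \<and>
     continuous_map (prod_topology TK TK) TK (\<lambda>(a, b). a + b) \<and>
     continuous_map (prod_topology TK TK) TK (\<lambda>(a, b). a * b) \<and>
     continuous_map (subtopology TK (- {0})) (subtopology TK (- {0})) inverse"

definition field_isomorphism :: "('k::field \<Rightarrow> 'l::field) \<Rightarrow> bool" where
  "field_isomorphism f \<longleftrightarrow>
     bij f \<and> f 1 = 1 \<and> (\<forall>a b. f (a + b) = f a + f b) \<and> (\<forall>a b. f (a * b) = f a * f b)"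

text \<open>The dimension as a cardinal, in the sense of the library's \<^const>\<open>card_of\<close>; the library's
  \<^const>\<open>vector_space.dim\<close> is a natural number and does not distinguish infinite dimensions.
  Bases exist for every vector space and any two of them are equipollent.\<close>

definition vs_dim :: "('k::field \<Rightarrow> 'x::ab_group_add \<Rightarrow> 'x) \<Rightarrow> 'x rel" where
  "vs_dim s = |SOME B. \<not> module.dependent s B \<and> module.span s B = UNIV|"

definition vector_topology ::
    "'k::field topology \<Rightarrow> ('k \<Rightarrow> 'x::ab_group_add \<Rightarrow> 'x) \<Rightarrow> 'x topology \<Rightarrow> bool" where
  "vector_topology TK s T \<longleftrightarrow>
     topspace T = UNIV \<and>
     continuous_map (prod_topology T T) T (\<lambda>(x, y). x + y) \<and>
     continuous_map (prod_topology TK T) T (\<lambda>(a, x). s a x)"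

text \<open>Smaller elements of the lattice are coarser topologies.\<close>

definition vector_topologies ::
    "'k::field topology \<Rightarrow> ('k \<Rightarrow> 'x::ab_group_add \<Rightarrow> 'x) \<Rightarrow> 'x topology gorder" where
  "vector_topologies TK s =
     \<lparr>carrier = {T. vector_topology TK s T},
      eq = (=),
      le = (\<lambda>S T. {U. openin S U} \<subseteq> {U. openin T U})\<rparr>"

definition Hausdorff_vector_topologies ::
    "'k::field topology \<Rightarrow> ('k \<Rightarrow> 'x::ab_group_add \<Rightarrow> 'x) \<Rightarrow> 'x topology set" where
  "Hausdorff_vector_topologies TK s = {T. vector_topology TK s T \<and> Hausdorff_space T}"

text \<open>The library's \<^const>\<open>join_pres\<close> and \<^const>\<open>meet_pres\<close> also assert that both structures
  are lattices; for \<^const>\<open>vector_topologies\<close> this always holds, see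
  \<open>complete_lattice_vector_topologies\<close> below.\<close>

definition lattice_isomorphism ::
    "('a, 'c) gorder_scheme \<Rightarrow> ('b, 'd) gorder_scheme \<Rightarrow> ('a \<Rightarrow> 'b) \<Rightarrow> bool" where
  "lattice_isomorphism L M f \<longleftrightarrow>
     bij_betw f (carrier L) (carrier M) \<and> join_pres L M f \<and> meet_pres L M f"

lemma vector_topologies_sel [simp]:
  "carrier (vector_topologies TK s) = {T. vector_topology TK s T}"
  "eq (vector_topologies TK s) = (=)"
  "le (vector_topologies TK s) S T \<longleftrightarrow> (\<forall>U. openin S U \<longrightarrow> openin T U)"
  by (auto simp: vector_topologies_def)

lemma partial_order_vector_topologies: "partial_order (vector_topologies TK s)"
  by unfold_locales (auto simp: topology_eq)

lemma sup_vector_topologies_exists: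
  fixes TK :: "'k::field topology" and s :: "'k \<Rightarrow> 'x::ab_group_add \<Rightarrow> 'x"
  assumes K: "topspace TK = UNIV"
    and A: "A \<subseteq> carrier (vector_topologies TK s)"
  shows "\<exists>S. least (vector_topologies TK s) S (Upper (vector_topologies TK s) A)"
proof
  let ?G = "insert UNIV {U. \<exists>T\<in>A. openin T U}"
  let ?S = "topology_generated_by ?G"
  have vt: "vector_topology TK s T" if "T \<in> A" for T
    using A that by auto
  have top: "topspace ?S = UNIV"
    by (simp only: topology_generated_by_topspace) blast
  have fine: "openin ?S U" if "T \<in> A" "openin T U" for T U
    using that by (intro topology_generated_by_Basis) blast
  have id: "continuous_map ?S T (\<lambda>x. x)" if "T \<in> A" for T
    using vt[OF that] fine[OF that] top
    by (auto simp: continuous_map_def vector_topology_def)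
  have cont: "continuous_map P ?S f"
    if "topspace P = UNIV" "\<And>T. T \<in> A \<Longrightarrow> continuous_map P T f" for P :: "'p topology" and f
  proof (rule continuous_on_generated_topo)
    fix U assume "U \<in> ?G"
    then consider "U = UNIV" | T where "T \<in> A" "openin T U" by blast
    then show "openin P (f -` U \<inter> topspace P)"
    proof cases
      case 1
      then show ?thesis by simp
    next
      case 2
      then show ?thesis
        using that(2)[of T] by (auto simp: continuous_map_alt)
    qed
  qed auto
  have S: "vector_topology TK s ?S"
    unfolding vector_topology_def
  proof (intro conjI)
    show "topspace ?S = UNIV" by (fact top)
    show "continuous_map (prod_topology ?S ?S) ?S (\<lambda>(x, y). x + y)"
    proof (rule cont)
      show "topspace (prod_topology ?S ?S) = UNIV"
        by (simp only: topspace_prod_topology top UNIV_Times_UNIV)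
      fix T assume T: "T \<in> A"
      have "continuous_map (prod_topology ?S ?S) (prod_topology T T) (\<lambda>p. (fst p, snd p))"
        using continuous_map_compose[OF continuous_map_fst id[OF T]]
          continuous_map_compose[OF continuous_map_snd id[OF T]]
        unfolding continuous_map_paired comp_def by blast
      then have "continuous_map (prod_topology ?S ?S) T ((\<lambda>(x, y). x + y) \<circ> (\<lambda>p. (fst p, snd p)))"
        using vt[OF T] unfolding vector_topology_def by (elim conjE) (rule continuous_map_compose)
      then show "continuous_map (prod_topology ?S ?S) T (\<lambda>(x, y). x + y)"
        by (simp add: comp_def case_prod_unfold)
    qed
    show "continuous_map (prod_topology TK ?S) ?S (\<lambda>(a, x). s a x)"
    proof (rule cont)
      show "topspace (prod_topology TK ?S) = UNIV"
        by (simp only: topspace_prod_topology top K UNIV_Times_UNIV)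
      fix T assume T: "T \<in> A"
      have "continuous_map (prod_topology TK ?S) (prod_topology TK T) (\<lambda>p. (fst p, snd p))"
        using continuous_map_fst[of TK ?S] continuous_map_compose[OF continuous_map_snd id[OF T]]
        unfolding continuous_map_paired comp_def by blast
      then have "continuous_map (prod_topology TK ?S) T ((\<lambda>(a, x). s a x) \<circ> (\<lambda>p. (fst p, snd p)))"
        using vt[OF T] unfolding vector_topology_def by (elim conjE) (rule continuous_map_compose)
      then show "continuous_map (prod_topology TK ?S) T (\<lambda>(a, x). s a x)"
        by (simp add: comp_def case_prod_unfold)
    qed
  qed
  have fin: "openin R U"
    if R: "vector_topology TK s R" "\<forall>T\<in>A. \<forall>V. openin T V \<longrightarrow> openin R V" and U: "openin ?S U" for R U
  proof -
    have "topspace R = UNIV"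
      using R(1) by (simp add: vector_topology_def)
    then have "openin R UNIV"
      using openin_topspace[of R] by simp
    have "generate_topology_on ?G U"
      using U by (rule openin_topology_generated_by)
    then show ?thesis
      by induction (use R(2) \<open>openin R UNIV\<close> in auto)
  qed
  let ?L = "vector_topologies TK s"
  have "?S \<in> Upper ?L A"
    using S by (simp add: Upper_def) (intro allI impI, elim conjE, rule fine)
  moreover have "le ?L ?S R" if "R \<in> Upper ?L A" for R
  proof -
    have R: "vector_topology TK s R"
      using that by (simp add: Upper_def)
    have "le ?L T R" if "T \<in> A" for T
      using Upper_memD[OF \<open>R \<in> Upper ?L A\<close> that A] by (rule conjunct1)
    then have "\<forall>T\<in>A. \<forall>V. openin T V \<longrightarrow> openin R V"
      unfolding vector_topologies_sel by (rule ballI)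
    from fin[OF R this] show ?thesis
      unfolding vector_topologies_sel by (intro allI impI)
  qed
  ultimately show "least ?L ?S (Upper ?L A)"
    unfolding least_def by (intro conjI ballI Upper_closed)
qed

lemma complete_lattice_vector_topologies:
  assumes K: "topspace TK = UNIV"
  shows "complete_lattice (vector_topologies TK s)"
proof -
  let ?L = "vector_topologies TK s"
  interpret partial_order ?L by (rule partial_order_vector_topologies)
  show ?thesis
  proof (rule complete_latticeI)
    fix A assume A: "A \<subseteq> carrier ?L"
    then show "\<exists>S. least ?L S (Upper ?L A)"
      by (rule sup_vector_topologies_exists[OF K])
    obtain S where S: "least ?L S (Upper ?L (Lower ?L A))"
      using sup_vector_topologies_exists[OF K Lower_closed] ..
    have SL: "S \<in> carrier ?L" and ub: "\<And>R. R \<in> Lower ?L A \<Longrightarrow> le ?L R S"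
      using S Lower_closed[of ?L A] unfolding least_def Upper_def by blast+
    have "le ?L S T" if "T \<in> A" for T
    proof -
      have "T \<in> Upper ?L (Lower ?L A)"
        using that A unfolding Upper_def Lower_def by blast
      then show ?thesis
        using S unfolding least_def by blast
    qed
    then have "S \<in> Lower ?L A"
      using SL unfolding Lower_def by blast
    then have "greatest ?L S (Lower ?L A)"
      using ub Lower_closed[of ?L A] unfolding greatest_def by blast
    then show "\<exists>S. greatest ?L S (Lower ?L A)" ..
  qed
qed

end

theory Submission
  imports Defs
begin

text \<open>
  Call the intersection of all open neighbourhoods of 0 the kernel of a vector topology. It is a
  linear subspace, it is \<open>{0}\<close> exactly for the Hausdorff topologies
  (\<open>Hausdorff_iff_topology_kernel\<close>), and the kernel of a join is the intersection of the
  kernels (\<open>topology_kernel_join\<close>). So two kernels meet trivially if and only if the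
  join of the two topologies is Hausdorff, and this is something that \<open>\<Phi>\<close> respects.

  Every subspace is a kernel (\<open>exists_topology_with_kernel\<close>), in particular every line. Hence
  the inclusion of kernels can be expressed through trivial intersections alone: \<open>S\<close> has a
  smaller kernel than \<open>T\<close> if and only if every kernel that meets that of \<open>T\<close> trivially also meets
  that of \<open>S\<close> trivially (\<open>topology_kernel_subset_iff\<close>). Therefore \<open>\<Phi>\<close> carries topologies with
  the same kernel to topologies with the same kernel, and on kernels it induces an isomorphism
  between the subspace lattices of \<open>X\<close> and \<open>Y\<close>.

  What remains is projective geometry. An isomorphism of subspace lattices maps lines through 0 to
  lines through 0, and after a choice of a vector on each line it becomes a map \<open>g\<close> with
  \<open>x \<in> span S\<close> if and only if \<open>g x \<in> span (g ` S)\<close>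
  (\<open>span_preserving_map_of_subspace_isomorphism\<close>). Such a map sends bases to bases, which gives the
  equality of dimensions. With three independent vectors, the classical introduction of
  coordinates gives the isomorphism of fields (\<open>exists_field_isomorphism\<close>): rescale the images
  \<open>f1, f2, f3\<close> of \<open>e1, e2, e3\<close> so that the line of \<open>e1 + e2\<close> goes to that of \<open>f1 + f2\<close> and the line
  of \<open>e1 + e3\<close> to that of \<open>f1 + f3\<close>, and let \<open>h a\<close> be the scalar for which the line of
  \<open>e1 + a e2\<close> goes to that of \<open>f1 + h(a) f2\<close>. Sums and products of scalars are determined by
  incidences between lines and planes through 0, so \<open>h\<close> is a ring homomorphism.
\<close>
section \<open>Coordinates in a vector space\<close>

context vector_space
begin

lemma in_span_pair_iff: "x \<in> span {a, b} \<longleftrightarrow> (\<exists>p q. x = scale p a + scale q b)"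
  by (auto simp: span_breakdown_eq algebra_simps)

lemma in_span_iff_singleton: "x \<in> span S \<longleftrightarrow> span {x} \<subseteq> span S"
  by (metis span_base span_minimal subspace_span empty_subsetI insert_subset singletonI subsetD)

lemma span_scale_singleton:
  assumes "c \<noteq> 0"
  shows "span {scale c x} = span {x}"
proof (rule span_eq[THEN iffD2], intro conjI)
  show "{scale c x} \<subseteq> span {x}"
    by (simp add: span_base span_scale)
  have "scale (inverse c) (scale c x) \<in> span {scale c x}"
    by (intro span_scale span_base) simp
  then show "{x} \<subseteq> span {scale c x}"
    using assms by simp
qed

lemma coordinate_eq_0:
  assumes "a \<notin> span {b, c}" and "scale p a + scale q b + scale r c = 0"
  shows "p = 0"
proof (rule ccontr)
  assume "p \<noteq> 0"
  have "scale p a = scale (- q) b + scale (- r) c"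
    using assms(2) by (simp add: algebra_simps eq_neg_iff_add_eq_0)
  then have "scale p a \<in> span {b, c}"
    by (auto simp only: in_span_pair_iff)
  from span_scale[OF this, of "inverse p"] \<open>p \<noteq> 0\<close> assms(1) show False
    by simp
qed

lemma coordinates_eq:
  assumes ind: "a \<notin> span {b, c}" "b \<notin> span {a, c}" "c \<notin> span {a, b}"
    and eq: "scale p a + scale q b + scale r c = scale p' a + scale q' b + scale r' c"
  shows "p = p' \<and> q = q' \<and> r = r'"
proof -
  have "scale (p - p') a + scale (q - q') b + scale (r - r') c = 0"
    "scale (q - q') b + scale (p - p') a + scale (r - r') c = 0"
    "scale (r - r') c + scale (p - p') a + scale (q - q') b = 0"
    using eq by (simp_all add: algebra_simps)
  from this[THEN coordinate_eq_0[rotated]] ind show ?thesis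
    by (simp add: insert_commute)
qed

lemma subspace_of_line:
  assumes "subspace N" "N \<subseteq> span {y}" "N \<noteq> {0}"
  shows "N = span {y}"
proof -
  obtain z where z: "z \<in> N" "z \<noteq> 0"
    using assms(1,3) subspace_0 by blast
  then obtain c where c: "z = scale c y"
    using assms(2) by (auto simp: span_singleton)
  then have "span {y} = span {z}"
    using z(2) span_scale_singleton[of c y] by auto
  also have "\<dots> \<subseteq> N"
    using z(1) assms(1) by (intro span_minimal) auto
  finally show ?thesis
    using assms(2) by blast
qed

lemma exists_basis: "\<exists>B. independent B \<and> span B = UNIV"
  using maximal_independent_subset[of UNIV] by (metis top.extremum_uniqueI)

lemma vs_dim_eq:
  assumes "independent B" "span B = UNIV"
  shows "vs_dim scale =o |B|"
proof -
  define C where "C = (SOME B. independent B \<and> span B = UNIV)"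
  have "independent C \<and> span C = UNIV"
    unfolding C_def by (rule someI_ex) (rule exists_basis)
  then have "\<exists>f. bij_betw f C B"
    using assms by (intro bij_if_span_eq_span_bases) auto
  then show ?thesis
    unfolding vs_dim_def C_def[symmetric] by (simp only: card_of_ordIso)
qed

end

section \<open>Maps that preserve and reflect spans\<close>

locale span_preserving_map =
  X: vector_space sX + Y: vector_space sY
  for sX :: "'k::field \<Rightarrow> 'x::ab_group_add \<Rightarrow> 'x" and sY :: "'l::field \<Rightarrow> 'y::ab_group_add \<Rightarrow> 'y" +
  fixes g :: "'x \<Rightarrow> 'y"
  assumes span_iff: "x \<in> X.span S \<longleftrightarrow> g x \<in> Y.span (g ` S)"
    and dominates: "\<exists>x. y \<in> Y.span {g x}"
begin

lemma image_of_basis: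
  assumes "X.independent B" "X.span B = UNIV"
  shows "Y.independent (g ` B)" "Y.span (g ` B) = UNIV" "inj_on g B"
proof -
  have nd: "b \<notin> X.span (B - {b})" if "b \<in> B" for b
    using assms(1) that by (auto simp: X.dependent_def)
  show inj: "inj_on g B"
  proof (rule inj_onI, rule ccontr)
    fix b c assume bc: "b \<in> B" "c \<in> B" "g b = g c" "b \<noteq> c"
    then have "g b \<in> Y.span (g ` (B - {b}))"
      by (intro Y.span_base) auto
    then show False
      using nd[OF bc(1)] span_iff by blast
  qed
  show "Y.independent (g ` B)"
    unfolding Y.dependent_def
  proof (intro notI, elim bexE imageE)
    fix y b assume b: "y \<in> Y.span (g ` B - {y})" "y = g b" "b \<in> B"
    have "g ` B - {y} = g ` (B - {b})"
      using inj b by (auto simp: inj_on_def)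
    then show False
      using nd[OF b(3)] b span_iff[of b "B - {b}"] by simp
  qed
  show "Y.span (g ` B) = UNIV"
  proof (rule UNIV_eq_I[symmetric])
    fix y
    obtain x where x: "y \<in> Y.span {g x}"
      using dominates by blast
    have "{g x} \<subseteq> Y.span (g ` B)"
      using span_iff[of x B] assms(2) by simp
    then show "y \<in> Y.span (g ` B)"
      using x Y.span_minimal[OF _ Y.subspace_span] by blast
  qed
qed

lemma vs_dim_eq_vs_dim: "vs_dim sX =o vs_dim sY"
proof -
  obtain B where B: "X.independent B" "X.span B = UNIV"
    using X.exists_basis by blast
  have "|B| =o |g ` B|"
    using image_of_basis(3)[OF B] by (intro card_of_ordIsoI) (rule inj_on_imp_bij_betw)
  then show ?thesis
    using X.vs_dim_eq[OF B] Y.vs_dim_eq[OF image_of_basis(1,2)[OF B]]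
    by (meson ordIso_symmetric ordIso_transitive)
qed

text \<open>The values of \<open>g\<close> matter only up to nonzero scalars, so images are treated as projective
  points: \<open>y\<close> is any vector on the line that corresponds to the line of \<open>x\<close>. The relation also
  holds between \<open>0\<close> and \<open>0\<close>, which avoids side conditions.\<close>
definition represents :: "'y \<Rightarrow> 'x \<Rightarrow> bool" where
  "represents y x \<longleftrightarrow> Y.span {y} = Y.span {g x}"

lemma represents_image: "represents (g x) x"
  by (simp add: represents_def)

text \<open>The only incidence statement that the coordinate argument needs: a point lies on the
  projective line through two others if and only if its image does.\<close>
lemma represents_in_span_iff:
  assumes "represents y x" "represents y1 x1" "represents y2 x2"
  shows "y \<in> Y.span {y1, y2} \<longleftrightarrow> x \<in> X.span {x1, x2}"
proof -
  have "Y.span {y1, y2} = Y.span {g x1, g x2}"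
    using assms(2,3) Y.span_Un[of "{y1}" "{y2}"] Y.span_Un[of "{g x1}" "{g x2}"]
    by (simp add: represents_def insert_commute)
  then show ?thesis
    using assms(1) span_iff[of x "{x1, x2}"]
    by (simp add: represents_def Y.in_span_iff_singleton)
qed

lemma represents_scale_left: "c \<noteq> 0 \<Longrightarrow> represents (sY c y) x \<longleftrightarrow> represents y x"
  by (simp add: represents_def Y.span_scale_singleton)

lemma represents_scale_right:
  assumes "c \<noteq> 0"
  shows "represents y (sX c x) \<longleftrightarrow> represents y x"
proof -
  have "Y.span {g (sX c x)} = Y.span {g x}"
  proof (rule Y.span_eq[THEN iffD2], intro conjI)
    have "x \<in> X.span {sX c x}" "sX c x \<in> X.span {x}"
      using X.span_scale_singleton[OF assms, of x] by (auto intro: X.span_base)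
    then show "{g (sX c x)} \<subseteq> Y.span {g x}" "{g x} \<subseteq> Y.span {g (sX c x)}"
      using span_iff by fastforce+
  qed
  then show ?thesis
    by (simp add: represents_def)
qed

lemma exists_represented: "\<exists>x. represents y x"
proof -
  obtain x c where x: "y = sY c (g x)"
    using dominates[of y] by (auto simp: Y.span_singleton)
  show ?thesis
  proof (cases "c = 0")
    case True
    have "g 0 = 0"
      using span_iff[of 0 "{}"] by simp
    then have "represents y 0"
      using True x by (simp add: represents_def)
    then show ?thesis ..
  next
    case False
    then show ?thesis
      using x represents_scale_left represents_image by blast
  qed
qed

text \<open>The points of the projective line through \<open>e1\<close> and \<open>e2\<close> other than \<open>e2\<close> itself are the affine
  points \<open>e1 + a e2\<close>; the image of such a point is on the line through \<open>f1\<close> and \<open>f2\<close> and is not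
  \<open>f2\<close>, so it is affine too.\<close>
lemma exists_line_coordinate:
  assumes "represents f1 e1" "represents f2 e2" "e1 \<notin> X.span {e2}"
  shows "\<exists>c. represents (f1 + sY c f2) (e1 + sX a e2)"
proof -
  let ?x = "e1 + sX a e2"
  have "?x = sX 1 e1 + sX a e2" by simp
  then have "?x \<in> X.span {e1, e2}"
    by (auto simp only: X.in_span_pair_iff)
  then have "g ?x \<in> Y.span {f1, f2}"
    using represents_in_span_iff[OF represents_image assms(1,2)] by blast
  then obtain p q where pq: "g ?x = sY p f1 + sY q f2"
    by (auto simp: Y.in_span_pair_iff)
  have "p \<noteq> 0"
  proof
    assume "p = 0"
    then have "g ?x \<in> Y.span {f2, f2}"
      using pq by (auto simp: Y.span_singleton)
    then have "?x \<in> X.span {e2}"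
      using represents_in_span_iff[OF represents_image assms(2,2)] by simp
    then have "?x - sX a e2 \<in> X.span {e2}"
      by (rule X.span_diff) (simp add: X.span_base X.span_scale)
    then show False
      using assms(3) by simp
  qed
  then have "g ?x = sY p (f1 + sY (q / p) f2)"
    by (simp add: pq Y.scale_right_distrib)
  then show ?thesis
    using represents_image[of ?x] represents_scale_left[OF \<open>p \<noteq> 0\<close>] by auto
qed

text \<open>The vector \<open>f1\<close> stays fixed and only \<open>f2\<close> is rescaled to make \<open>1\<close> the coordinate of \<open>1\<close>. So
  one \<open>f1\<close> serves for two coordinate axes at once.\<close>
lemma exists_normalized_coordinate:
  assumes "represents f1 e1" "e1 \<notin> X.span {e2}" "e2 \<notin> X.span {e1}"
  shows "\<exists>f2 h. represents f2 e2 \<and> h 1 = 1 \<and> (\<forall>a. represents (f1 + sY (h a) f2) (e1 + sX a e2))"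
proof -
  obtain c where c: "represents (f1 + sY c (g e2)) (e1 + sX 1 e2)"
    using exists_line_coordinate[OF assms(1) represents_image assms(2)] by blast
  have "c \<noteq> 0"
  proof
    assume "c = 0"
    then have "f1 \<in> Y.span {f1, f1} \<longleftrightarrow> e1 + e2 \<in> X.span {e1, e1}"
      using c by (intro represents_in_span_iff assms) simp
    then have "e1 + e2 \<in> X.span {e1}"
      by (simp add: Y.span_base)
    then have "e1 + e2 - e1 \<in> X.span {e1}"
      by (rule X.span_diff) (simp add: X.span_base)
    then show False
      using assms(3) by simp
  qed
  then have f2: "represents (sY c (g e2)) e2"
    using represents_scale_left represents_image by blast
  obtain k where k: "\<And>a. represents (f1 + sY (k a) (sY c (g e2))) (e1 + sX a e2)"
    using exists_line_coordinate[OF assms(1) f2 assms(2)] by metis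
  show ?thesis
    using f2 c k by (intro exI[of _ "sY c (g e2)"] exI[of _ "k(1 := 1)"]) auto
qed

text \<open>Two coordinate functions, \<open>h\<close> on the axis of \<open>e2\<close> and \<open>k\<close> on that of \<open>e3\<close>, locate the images
  of all affine points \<open>e1 + a e2 + b e3\<close> and of the points \<open>a e2 + e3\<close> at infinity. The identity
  \<open>e1 + (a + b) e2 + e3 = (e1 + a e2) + (b e2 + e3)\<close> then shows that \<open>h\<close> is additive, and
  \<open>e1 + a b e2 + b e3 = e1 + b (a e2 + e3)\<close> gives \<open>h (a b) = h a * k b\<close>; with \<open>a = 1\<close> the latter
  says that \<open>h\<close> and \<open>k\<close> agree.\<close>
theorem exists_field_isomorphism:
  assumes e: "e1 \<notin> X.span {e2, e3}" "e2 \<notin> X.span {e1, e3}" "e3 \<notin> X.span {e1, e2}"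
  shows "\<exists>h :: 'k \<Rightarrow> 'l. field_isomorphism h"
proof -
  have e12: "e1 \<notin> X.span {e2}" "e2 \<notin> X.span {e1}" "e1 \<notin> X.span {e3}" "e3 \<notin> X.span {e1}"
    using e X.span_mono[of "{e2}" "{e2, e3}"] X.span_mono[of "{e1}" "{e1, e3}"]
      X.span_mono[of "{e3}" "{e2, e3}"] X.span_mono[of "{e1}" "{e1, e2}"] by auto
  define f1 where "f1 = g e1"
  have f1: "represents f1 e1"
    by (simp add: f1_def represents_image)
  obtain f2 h where f2: "represents f2 e2" and h1: "h 1 = 1"
    and h: "\<And>a. represents (f1 + sY (h a) f2) (e1 + sX a e2)"
    using exists_normalized_coordinate[OF f1 e12(1,2)] by metis
  obtain f3 k where f3: "represents f3 e3" and k1: "k 1 = 1"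
    and k: "\<And>a. represents (f1 + sY (k a) f3) (e1 + sX a e3)"
    using exists_normalized_coordinate[OF f1 e12(3,4)] by metis
  have f: "f1 \<notin> Y.span {f2, f3}" "f2 \<notin> Y.span {f1, f3}" "f3 \<notin> Y.span {f1, f2}"
    using e represents_in_span_iff f1 f2 f3 by blast+
  have coord: "p = p' \<and> q = q' \<and> r = r'"
    if "sY p f1 + sY q f2 + sY r f3 = sY p' f1 + sY q' f2 + sY r' f3" for p q r p' q' r'
    using Y.coordinates_eq[OF f that] .
  have nz: "x \<noteq> 0 \<Longrightarrow> represents y x \<Longrightarrow> y \<noteq> 0" for x y
    using represents_in_span_iff[of y x "0" "0" "0" "0"] span_iff[of x "{}"] span_iff[of 0 "{}"]
    by (auto simp: represents_def)
  \<comment> \<open>An affine point is the intersection of the lines that project it from \<open>e3\<close> to the axis of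
    \<open>e2\<close> and from \<open>e2\<close> to the axis of \<open>e3\<close>.\<close>
  have plane: "represents (f1 + sY (h a) f2 + sY (k b) f3) (e1 + sX a e2 + sX b e3)" for a b
  proof -
    let ?x = "e1 + sX a e2 + sX b e3"
    let ?y = "g ?x"
    have "?x = sX 1 (e1 + sX a e2) + sX b e3" "?x = sX 1 (e1 + sX b e3) + sX a e2"
      by (simp_all add: algebra_simps)
    then have "?x \<in> X.span {e1 + sX a e2, e3}" "?x \<in> X.span {e1 + sX b e3, e2}"
      by (metis X.in_span_pair_iff)+
    then have "?y \<in> Y.span {f1 + sY (h a) f2, f3}" "?y \<in> Y.span {f1 + sY (k b) f3, f2}"
      using represents_in_span_iff[OF represents_image h f3]
        represents_in_span_iff[OF represents_image k f2] by blast+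
    then obtain p q r s where y: "?y = sY p (f1 + sY (h a) f2) + sY q f3"
        "?y = sY r (f1 + sY (k b) f3) + sY s f2"
      by (metis Y.in_span_pair_iff)
    then have "sY p f1 + sY (p * h a) f2 + sY q f3 = sY r f1 + sY s f2 + sY (r * k b) f3"
      by (simp add: algebra_simps)
    from coord[OF this] have eq: "?y = sY p (f1 + sY (h a) f2 + sY (k b) f3)"
      using y(1) by (simp add: algebra_simps)
    have "?x \<noteq> 0"
      using X.coordinate_eq_0[OF e(1), of 1 a b] by auto
    then have "p \<noteq> 0"
      using nz[OF _ represents_image] eq by auto
    then show ?thesis
      using represents_image[of ?x] represents_scale_left eq by simp
  qed
  \<comment> \<open>A point at infinity is where the line from \<open>e1\<close> through \<open>e1 + a e2 + e3\<close> meets the line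
    through \<open>e2\<close> and \<open>e3\<close>.\<close>
  have infinity: "represents (sY (h a) f2 + f3) (sX a e2 + e3)" for a
  proof -
    let ?x = "sX a e2 + e3"
    let ?y = "g ?x"
    have "?x = sX a e2 + sX 1 e3" "?x = sX (- 1) e1 + sX 1 (e1 + sX a e2 + sX 1 e3)"
      by (simp_all add: algebra_simps)
    then have "?x \<in> X.span {e2, e3}" "?x \<in> X.span {e1, e1 + sX a e2 + sX 1 e3}"
      by (metis X.in_span_pair_iff)+
    then have "?y \<in> Y.span {f2, f3}" "?y \<in> Y.span {f1, f1 + sY (h a) f2 + sY (k 1) f3}"
      using represents_in_span_iff[OF represents_image f2 f3]
        represents_in_span_iff[OF represents_image f1 plane] by blast+
    then obtain p q r s where y: "?y = sY p f2 + sY q f3"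
        "?y = sY r f1 + sY s (f1 + sY (h a) f2 + sY (k 1) f3)"
      by (metis Y.in_span_pair_iff)
    then have "sY 0 f1 + sY p f2 + sY q f3 = sY (r + s) f1 + sY (s * h a) f2 + sY s f3"
      by (simp add: algebra_simps k1)
    from coord[OF this] have eq: "?y = sY q (sY (h a) f2 + f3)"
      using y(1) by (simp add: algebra_simps)
    have "?x \<noteq> 0"
      using X.coordinate_eq_0[OF e(3), of 1 0 a] by (auto simp: add.commute)
    then have "q \<noteq> 0"
      using nz[OF _ represents_image] eq by auto
    then show ?thesis
      using represents_image[of ?x] represents_scale_left eq by simp
  qed
  have add: "h (a + b) = h a + h b" for a b
  proof -
    have "e1 + sX (a + b) e2 + sX 1 e3 = sX 1 (e1 + sX a e2) + sX 1 (sX b e2 + e3)"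
      by (simp add: algebra_simps)
    then have "e1 + sX (a + b) e2 + sX 1 e3 \<in> X.span {e1 + sX a e2, sX b e2 + e3}"
      by (metis X.in_span_pair_iff)
    then have "f1 + sY (h (a + b)) f2 + sY (k 1) f3 \<in> Y.span {f1 + sY (h a) f2, sY (h b) f2 + f3}"
      using represents_in_span_iff[OF plane h infinity] by blast
    then obtain p q where "f1 + sY (h (a + b)) f2 + sY (k 1) f3
        = sY p (f1 + sY (h a) f2) + sY q (sY (h b) f2 + f3)"
      by (auto simp: Y.in_span_pair_iff)
    then have "sY 1 f1 + sY (h (a + b)) f2 + sY 1 f3
        = sY p f1 + sY (p * h a + q * h b) f2 + sY q f3"
      by (simp add: algebra_simps k1)
    from coord[OF this] show ?thesis
      by auto
  qed
  have mult': "h (a * b) = h a * k b" for a b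
  proof -
    have "e1 + sX (a * b) e2 + sX b e3 = sX 1 e1 + sX b (sX a e2 + e3)"
      by (simp add: algebra_simps)
    then have "e1 + sX (a * b) e2 + sX b e3 \<in> X.span {e1, sX a e2 + e3}"
      by (metis X.in_span_pair_iff)
    then have "f1 + sY (h (a * b)) f2 + sY (k b) f3 \<in> Y.span {f1, sY (h a) f2 + f3}"
      using represents_in_span_iff[OF plane f1 infinity] by blast
    then obtain p q where "f1 + sY (h (a * b)) f2 + sY (k b) f3
        = sY p f1 + sY q (sY (h a) f2 + f3)"
      by (auto simp: Y.in_span_pair_iff)
    then have "sY 1 f1 + sY (h (a * b)) f2 + sY (k b) f3
        = sY p f1 + sY (q * h a) f2 + sY q f3"
      by (simp add: algebra_simps)
    from coord[OF this] show ?thesis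
      by auto
  qed
  have mult: "h (a * b) = h a * h b" for a b
    using mult'[of a b] mult'[of 1 b] h1 by simp
  have "inj h"
  proof (rule injI)
    fix a b assume "h a = h b"
    then have "represents (f1 + sY (h a) f2) (e1 + sX a e2)" "represents (f1 + sY (h a) f2) (e1 + sX b e2)"
      using h[of a] h[of b] by auto
    then have "e1 + sX a e2 \<in> X.span {e1 + sX b e2, e1 + sX b e2}"
      using represents_in_span_iff by (meson Y.span_base insertI1)
    then obtain c where "e1 + sX a e2 = sX c (e1 + sX b e2)"
      by (auto simp: X.span_singleton)
    then have "sX 1 e1 + sX a e2 + sX 0 e3 = sX c e1 + sX (c * b) e2 + sX 0 e3"
      by (simp add: algebra_simps)
    from X.coordinates_eq[OF e this] show "a = b"
      by auto
  qed
  moreover have "surj h"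
  proof (unfold surj_def, intro allI)
    fix c
    obtain x where x: "represents (f1 + sY c f2) x"
      using exists_represented by blast
    have "f1 + sY c f2 = sY 1 f1 + sY c f2" by simp
    then have "f1 + sY c f2 \<in> Y.span {f1, f2}"
      by (metis Y.in_span_pair_iff)
    then have "x \<in> X.span {e1, e2}"
      using represents_in_span_iff[OF x f1 f2] by blast
    then obtain p q where pq: "x = sX p e1 + sX q e2"
      by (auto simp: X.in_span_pair_iff)
    have "p \<noteq> 0"
    proof
      assume "p = 0"
      then have "x \<in> X.span {e2, e2}"
        using pq by (auto simp: X.span_singleton)
      then have "f1 + sY c f2 \<in> Y.span {f2, f2}"
        using represents_in_span_iff[OF x f2 f2] by blast
      then obtain d where "f1 + sY c f2 = sY d f2"
        by (auto simp: Y.span_singleton)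
      then have "sY 1 f1 + sY c f2 + sY 0 f3 = sY 0 f1 + sY d f2 + sY 0 f3"
        by simp
      from coord[OF this] show False
        by simp
    qed
    then have "x = sX p (e1 + sX (q / p) e2)"
      by (simp add: pq X.scale_right_distrib)
    then have "represents (f1 + sY c f2) (e1 + sX (q / p) e2)"
      using x represents_scale_right[OF \<open>p \<noteq> 0\<close>] by simp
    then have "f1 + sY c f2 \<in> Y.span {f1 + sY (h (q / p)) f2}"
      using h[of "q / p"] by (metis Y.span_base insertI1 represents_def)
    then obtain d where "f1 + sY c f2 = sY d (f1 + sY (h (q / p)) f2)"
      by (auto simp: Y.span_singleton)
    then have "sY 1 f1 + sY c f2 + sY 0 f3 = sY d f1 + sY (d * h (q / p)) f2 + sY 0 f3"
      by (simp add: algebra_simps)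
    from coord[OF this] show "\<exists>a. c = h a"
      by auto
  qed
  ultimately show ?thesis
    unfolding field_isomorphism_def bij_def using h1 add mult by blast
qed

end

section \<open>Isomorphic subspace lattices\<close>

text \<open>Lines are the atoms of the subspace lattice and \<open>span S\<close> is the supremum of the lines of the
  elements of \<open>S\<close>, so both notions are transported by \<open>\<psi>\<close>; \<open>g x\<close> is a generator of the image of
  the line of \<open>x\<close>.\<close>
lemma span_preserving_map_of_subspace_isomorphism:
  fixes sX :: "'k::field \<Rightarrow> 'x::ab_group_add \<Rightarrow> 'x" and sY :: "'l::field \<Rightarrow> 'y::ab_group_add \<Rightarrow> 'y"
  assumes "vector_space sX" "vector_space sY"
    and sub: "\<And>M. module.subspace sX M \<Longrightarrow> module.subspace sY (\<psi> M)"
    and surj: "\<And>N. module.subspace sY N \<Longrightarrow> \<exists>M. module.subspace sX M \<and> \<psi> M = N"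
    and mono: "\<And>M M'. module.subspace sX M \<Longrightarrow> module.subspace sX M' \<Longrightarrow> \<psi> M \<subseteq> \<psi> M' \<longleftrightarrow> M \<subseteq> M'"
  shows "\<exists>g. span_preserving_map sX sY g"
proof -
  interpret X: vector_space sX by fact
  interpret Y: vector_space sY by fact
  have zero: "\<psi> {0} = {0}"
  proof -
    obtain M where M: "X.subspace M" "\<psi> M = {0}"
      using surj[OF Y.subspace_single_0] by blast
    then have "\<psi> {0} \<subseteq> {0}"
      using mono[OF X.subspace_single_0 M(1)] X.subspace_0 by auto
    then show ?thesis
      using Y.subspace_0[OF sub[OF X.subspace_single_0]] by blast
  qed
  have nonzero: "\<psi> M \<noteq> {0} \<longleftrightarrow> M \<noteq> {0}" if "X.subspace M" for M
    using zero mono[OF that X.subspace_single_0] X.subspace_0[OF that] Y.subspace_0[OF sub[OF that]]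
    by auto
  have "\<exists>y. \<psi> (X.span {x}) = Y.span {y}" for x
  proof (cases "x = 0")
    case True
    then have "\<psi> (X.span {x}) = Y.span {0}"
      using zero by simp
    then show ?thesis ..
  next
    case False
    then have "X.span {x} \<noteq> {0}"
      using X.span_base[of x "{x}"] by auto
    then have ne: "\<psi> (X.span {x}) \<noteq> {0}"
      using nonzero by simp
    then obtain y where y: "y \<in> \<psi> (X.span {x})" "y \<noteq> 0"
      using Y.subspace_0[OF sub[OF X.subspace_span]] by blast
    obtain M where M: "X.subspace M" "\<psi> M = Y.span {y}"
      using surj[OF Y.subspace_span] by blast
    have "\<psi> M \<subseteq> \<psi> (X.span {x})"
      unfolding M(2) using y sub by (intro Y.span_minimal) auto
    then have "M \<subseteq> X.span {x}"
      using mono[OF M(1) X.subspace_span] by blast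
    moreover have "M \<noteq> {0}"
      using nonzero[OF M(1)] M(2) y(2) Y.span_base[of y "{y}"] by auto
    ultimately have "M = X.span {x}"
      using X.subspace_of_line[OF M(1)] by blast
    then show ?thesis
      using M(2) by blast
  qed
  then obtain g where g: "\<And>x. \<psi> (X.span {x}) = Y.span {g x}"
    by metis
  have span: "\<psi> (X.span S) = Y.span (g ` S)" for S
  proof
    obtain M where M: "X.subspace M" "\<psi> M = Y.span (g ` S)"
      using surj[OF Y.subspace_span] by blast
    have "x \<in> M" if "x \<in> S" for x
    proof -
      have "\<psi> (X.span {x}) \<subseteq> \<psi> M"
        unfolding g M(2) using that by (intro Y.span_mono) auto
      then show ?thesis
        using mono[OF X.subspace_span M(1)] X.span_base[of x "{x}"] by auto
    qed
    then have "X.span S \<subseteq> M"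
      using M(1) by (intro X.span_minimal) auto
    then show "\<psi> (X.span S) \<subseteq> Y.span (g ` S)"
      using mono[OF X.subspace_span M(1)] M(2) by simp
    show "Y.span (g ` S) \<subseteq> \<psi> (X.span S)"
    proof (rule Y.span_minimal[OF _ sub[OF X.subspace_span]], rule image_subsetI)
      fix x assume "x \<in> S"
      then have "\<psi> (X.span {x}) \<subseteq> \<psi> (X.span S)"
        using mono[OF X.subspace_span X.subspace_span] X.span_mono[of "{x}" S] by auto
      then show "g x \<in> \<psi> (X.span S)"
        using g Y.span_base[of "g x" "{g x}"] by auto
    qed
  qed
  have "span_preserving_map sX sY g"
  proof
    fix x S
    have "x \<in> X.span S \<longleftrightarrow> X.span {x} \<subseteq> X.span S"
      by (rule X.in_span_iff_singleton)
    also have "\<dots> \<longleftrightarrow> Y.span {g x} \<subseteq> Y.span (g ` S)"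
      using mono[OF X.subspace_span X.subspace_span, of "{x}" S] span[of "{x}"] span[of S] by simp
    also have "\<dots> \<longleftrightarrow> g x \<in> Y.span (g ` S)"
      by (rule Y.in_span_iff_singleton[symmetric])
    finally show "x \<in> X.span S \<longleftrightarrow> g x \<in> Y.span (g ` S)" .
  next
    fix y
    obtain M where M: "X.subspace M" "\<psi> M = Y.span {y}"
      using surj[OF Y.subspace_span] by blast
    show "\<exists>x. y \<in> Y.span {g x}"
    proof (cases "M = {0}")
      case True
      then have "y = 0"
        using M(2) zero Y.span_base[of y "{y}"] by auto
      then have "y \<in> Y.span {g 0}"
        by (simp add: Y.span_zero)
      then show ?thesis ..
    next
      case False
      then obtain x where x: "x \<in> M" "x \<noteq> 0"
        using X.subspace_0[OF M(1)] by blast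
      have "X.span {x} \<subseteq> M"
        using M(1) x by (intro X.span_minimal) auto
      then have "Y.span {g x} \<subseteq> Y.span {y}"
        using mono[OF X.subspace_span M(1)] g M(2) by metis
      moreover have "X.span {x} \<noteq> {0}"
        using x(2) X.span_base[of x "{x}"] by auto
      then have "Y.span {g x} \<noteq> {0}"
        using nonzero[OF X.subspace_span] g by metis
      ultimately have "Y.span {g x} = Y.span {y}"
        by (intro Y.subspace_of_line Y.subspace_span)
      then show ?thesis
        using Y.span_base[of y "{y}"] by auto
    qed
  qed
  then show ?thesis
    by blast
qed

section \<open>Kernels of vector topologies\<close>

lemma continuous_map_prod_iff:
  assumes "topspace R = UNIV" "topspace S = UNIV" "topspace T = UNIV"
  shows "continuous_map (prod_topology R S) T (\<lambda>(x, y). f x y) \<longleftrightarrow>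
    (\<forall>U x y. openin T U \<and> f x y \<in> U \<longrightarrow>
      (\<exists>A B. openin R A \<and> openin S B \<and> x \<in> A \<and> y \<in> B \<and> (\<forall>a\<in>A. \<forall>b\<in>B. f a b \<in> U)))"
  (is "_ \<longleftrightarrow> ?rhs")
proof -
  have "continuous_map (prod_topology R S) T (\<lambda>(x, y). f x y) \<longleftrightarrow>
    (\<forall>U. openin T U \<longrightarrow> openin (prod_topology R S) {p. f (fst p) (snd p) \<in> U})"
    by (simp add: continuous_map_def assms case_prod_unfold)
  also have "\<dots> \<longleftrightarrow> ?rhs"
    unfolding openin_prod_topology_alt by (simp add: subset_iff Ball_def) meson
  finally show ?thesis .
qed

text \<open>For a vector topology this is the closure of \<open>{0}\<close>.\<close>
definition topology_kernel :: "'x::ab_group_add topology \<Rightarrow> 'x set" where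
  "topology_kernel T = {x. \<forall>U. openin T U \<and> 0 \<in> U \<longrightarrow> x \<in> U}"

lemma zero_in_topology_kernel: "0 \<in> topology_kernel T"
  by (simp add: topology_kernel_def)

locale vector_space_over_topological_field =
  vector_space s for s :: "'k::field \<Rightarrow> 'x::ab_group_add \<Rightarrow> 'x" +
  fixes TK :: "'k topology"
  assumes topological_field: "topological_field TK"
begin

lemma topspace_field: "topspace TK = UNIV"
  using topological_field by (simp add: topological_field_def)

lemma vector_topology_iff:
  "vector_topology TK s T \<longleftrightarrow> topspace T = UNIV \<and>
    (\<forall>U x y. openin T U \<and> x + y \<in> U \<longrightarrow>
      (\<exists>A B. openin T A \<and> openin T B \<and> x \<in> A \<and> y \<in> B \<and> (\<forall>a\<in>A. \<forall>b\<in>B. a + b \<in> U))) \<and>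
    (\<forall>U c x. openin T U \<and> s c x \<in> U \<longrightarrow>
      (\<exists>A B. openin TK A \<and> openin T B \<and> c \<in> A \<and> x \<in> B \<and> (\<forall>a\<in>A. \<forall>b\<in>B. s a b \<in> U)))"
  using continuous_map_prod_iff[of T T T "(+)"] continuous_map_prod_iff[of TK T T s]
  by (auto simp: vector_topology_def topspace_field)

lemma vector_topology_add_nbhd:
  assumes "vector_topology TK s T" "openin T U" "x + y \<in> U"
  obtains A B where "openin T A" "openin T B" "x \<in> A" "y \<in> B" "\<And>a b. a \<in> A \<Longrightarrow> b \<in> B \<Longrightarrow> a + b \<in> U"
  using assms unfolding vector_topology_iff by metis

lemma vector_topology_scale_nbhd:
  assumes "vector_topology TK s T" "openin T U" "s c x \<in> U"
  obtains A B where "openin TK A" "openin T B" "c \<in> A" "x \<in> B" "\<And>a b. a \<in> A \<Longrightarrow> b \<in> B \<Longrightarrow> s a b \<in> U"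
  using assms unfolding vector_topology_iff by metis

lemma subspace_topology_kernel:
  assumes T: "vector_topology TK s T"
  shows "subspace (topology_kernel T)"
  unfolding subspace_def
proof (intro conjI ballI allI)
  show "0 \<in> topology_kernel T"
    by (rule zero_in_topology_kernel)
  fix x y assume "x \<in> topology_kernel T" "y \<in> topology_kernel T"
  then show "x + y \<in> topology_kernel T"
    unfolding topology_kernel_def mem_Collect_eq
    by (metis vector_topology_add_nbhd[OF T, of _ 0 0] add.right_neutral)
next
  fix c x assume x: "x \<in> topology_kernel T"
  have "s c x \<in> U" if U: "openin T U" "0 \<in> U" for U
  proof -
    have "s c 0 \<in> U" using U by simp
    from vector_topology_scale_nbhd[OF T U(1) this] show ?thesis
      using x unfolding topology_kernel_def mem_Collect_eq by metis
  qed
  then show "s c x \<in> topology_kernel T"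
    by (simp add: topology_kernel_def)
qed

lemma openin_translate_kernel:
  assumes T: "vector_topology TK s T" and "openin T U" "u \<in> U" "m \<in> topology_kernel T"
  shows "u + m \<in> U"
proof -
  have "u + 0 \<in> U" using assms by simp
  from vector_topology_add_nbhd[OF T assms(2) this] show ?thesis
    using assms(4) unfolding topology_kernel_def mem_Collect_eq by metis
qed

lemma Hausdorff_iff_topology_kernel:
  assumes T: "vector_topology TK s T"
  shows "Hausdorff_space T \<longleftrightarrow> topology_kernel T = {0}"
proof
  have top: "topspace T = UNIV"
    using T by (simp add: vector_topology_def)
  {
    assume H: "Hausdorff_space T"
    have "x = 0" if x: "x \<in> topology_kernel T" for x
    proof (rule ccontr)
      assume "x \<noteq> 0"
      then obtain U V where "openin T U" "openin T V" "0 \<in> U" "x \<in> V" "disjnt U V"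
        using H top unfolding Hausdorff_space_def by (metis UNIV_I)
      then show False
        using x by (auto simp: topology_kernel_def disjnt_iff)
    qed
    then show "topology_kernel T = {0}"
      using zero_in_topology_kernel by blast
  next
    assume K: "topology_kernel T = {0}"
    show "Hausdorff_space T"
      unfolding Hausdorff_space_def
    proof (intro allI impI)
      fix x y assume "x \<in> topspace T \<and> y \<in> topspace T \<and> x \<noteq> y"
      then have "y - x \<notin> topology_kernel T"
        using K by (metis right_minus_eq singletonD)
      then obtain U where U: "openin T U" "0 \<in> U" "y - x \<notin> U"
        by (auto simp: topology_kernel_def)
      have "x + (- x) \<in> U"
        using U by simp
      then obtain A B where A: "openin T A" "openin T B" "x \<in> A" "- x \<in> B"
          "\<And>a b. a \<in> A \<Longrightarrow> b \<in> B \<Longrightarrow> a + b \<in> U"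
        using vector_topology_add_nbhd[OF T U(1)] by metis
      \<comment> \<open>Negation is multiplication by \<open>-1\<close>, so \<open>y - x - z\<close> stays in \<open>B\<close> for \<open>z\<close> near \<open>y\<close>; for \<open>z\<close>
        also in \<open>A\<close> this would put \<open>y - x\<close> into \<open>U\<close>.\<close>
      have "s (- 1) y + (y - x) \<in> B"
        using A by simp
      then obtain P Q where P: "openin T P" "s (- 1) y \<in> P" "y - x \<in> Q"
          "\<And>a b. a \<in> P \<Longrightarrow> b \<in> Q \<Longrightarrow> a + b \<in> B"
        using vector_topology_add_nbhd[OF T A(2)] by metis
      obtain N C where C: "openin T C" "- 1 \<in> N" "y \<in> C" "\<And>a b. a \<in> N \<Longrightarrow> b \<in> C \<Longrightarrow> s a b \<in> P"
        using vector_topology_scale_nbhd[OF T P(1,2)] by metis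
      have "z \<notin> C" if "z \<in> A" for z
      proof
        assume "z \<in> C"
        then have "s (- 1) z + (y - x) \<in> B"
          using C P by blast
        from A(5)[OF that this] show False
          using U(3) by simp
      qed
      then show "\<exists>U V. openin T U \<and> openin T V \<and> x \<in> U \<and> y \<in> V \<and> disjnt U V"
        using A C unfolding disjnt_iff by blast
    qed
  }
qed

text \<open>The open sets invariant under translation by \<open>M\<close> are the preimages of the open sets of the
  quotient by \<open>M\<close>. They form a vector topology because the saturation \<open>A + M\<close> of an open set is
  open. This coarsening is what bounds the kernel of a supremum from below.\<close>
lemma vector_topology_invariant_opens:
  assumes T: "vector_topology TK s T" and M: "subspace M"
  shows "\<exists>T'. vector_topology TK s T' \<and>
    (\<forall>U. openin T' U \<longleftrightarrow> openin T U \<and> (\<forall>u\<in>U. \<forall>m\<in>M. u + m \<in> U))"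
proof -
  define P where "P U \<longleftrightarrow> openin T U \<and> (\<forall>u\<in>U. \<forall>m\<in>M. u + m \<in> U)" for U
  define T' where "T' = topology P"
  have "istopology P"
    unfolding istopology_def P_def by blast
  then have open': "openin T' U \<longleftrightarrow> P U" for U
    by (simp add: T'_def topology_inverse')
  have P_UNIV: "P UNIV"
    using T openin_topspace[of T] by (simp add: P_def vector_topology_def)
  define sat where "sat A = {z. \<exists>m\<in>M. z + m \<in> A}" for A
  have sat: "P (sat A)" if A: "openin T A" for A
    unfolding P_def
  proof (intro conjI ballI)
    show "openin T (sat A)"
    proof (subst openin_subopen, intro ballI)
      fix z assume "z \<in> sat A"
      then obtain m where m: "m \<in> M" "z + m \<in> A"
        by (auto simp: sat_def)
      then obtain C D where "openin T C" "z \<in> C" "m \<in> D" "\<And>c d. c \<in> C \<Longrightarrow> d \<in> D \<Longrightarrow> c + d \<in> A"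
        using vector_topology_add_nbhd[OF T A] by metis
      then show "\<exists>V. openin T V \<and> z \<in> V \<and> V \<subseteq> sat A"
        using m(1) unfolding sat_def by blast
    qed
    fix u m assume "u \<in> sat A" "m \<in> M"
    then obtain n where n: "n \<in> M" "u + n \<in> A"
      by (auto simp: sat_def)
    have "n - m \<in> M" "u + m + (n - m) \<in> A"
      using n \<open>m \<in> M\<close> subspace_diff[OF M] by (auto simp: algebra_simps)
    then show "u + m \<in> sat A"
      unfolding sat_def by blast
  qed
  have sat_incl: "A \<subseteq> sat A" for A
    using subspace_0[OF M] by (force simp: sat_def)
  have unsat: "w \<in> U" if "P U" "w + m \<in> U" "m \<in> M" for U w m
    using that subspace_neg[OF M, of m] by (fastforce simp: P_def)
  have "vector_topology TK s T'"
    unfolding vector_topology_iff open'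
  proof (intro conjI allI impI)
    show "topspace T' = UNIV"
      using P_UNIV open' by (metis openin_subset top.extremum_uniqueI)
  next
    fix U x y assume U: "P U \<and> x + y \<in> U"
    then obtain A B where AB: "openin T A" "openin T B" "x \<in> A" "y \<in> B"
        "\<And>a b. a \<in> A \<Longrightarrow> b \<in> B \<Longrightarrow> a + b \<in> U"
      using vector_topology_add_nbhd[OF T, of U x y] unfolding P_def by metis
    have "a + b \<in> U" if ab: "a \<in> sat A" "b \<in> sat B" for a b
    proof -
      obtain m n where "m \<in> M" "n \<in> M" "a + m \<in> A" "b + n \<in> B"
        using ab unfolding sat_def by blast
      then have "(a + b) + (m + n) \<in> U" "m + n \<in> M"
        using AB(5)[of "a + m" "b + n"] subspace_add[OF M] by (auto simp: algebra_simps)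
      then show ?thesis
        using U unsat by blast
    qed
    then show "\<exists>A B. P A \<and> P B \<and> x \<in> A \<and> y \<in> B \<and> (\<forall>a\<in>A. \<forall>b\<in>B. a + b \<in> U)"
      by (intro exI[of _ "sat A"] exI[of _ "sat B"] conjI ballI sat subsetD[OF sat_incl] AB(1-4))
  next
    fix U c x assume U: "P U \<and> s c x \<in> U"
    then obtain A B where AB: "openin TK A" "openin T B" "c \<in> A" "x \<in> B"
        "\<And>a b. a \<in> A \<Longrightarrow> b \<in> B \<Longrightarrow> s a b \<in> U"
      using vector_topology_scale_nbhd[OF T, of U c x] unfolding P_def by metis
    have "s a b \<in> U" if ab: "a \<in> A" "b \<in> sat B" for a b
    proof -
      obtain m where "m \<in> M" "b + m \<in> B"
        using ab(2) unfolding sat_def by blast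
      then have "s a b + s a m \<in> U" "s a m \<in> M"
        using AB(5)[OF ab(1), of "b + m"] subspace_scale[OF M] by (auto simp: scale_right_distrib)
      then show ?thesis
        using U unsat by blast
    qed
    then show "\<exists>A B. openin TK A \<and> P B \<and> c \<in> A \<and> x \<in> B \<and> (\<forall>a\<in>A. \<forall>b\<in>B. s a b \<in> U)"
      by (intro exI[of _ A] exI[of _ "sat B"] conjI ballI sat subsetD[OF sat_incl] AB(1-4))
  qed
  then show ?thesis
    using open' P_def by blast
qed

text \<open>Let \<open>M\<close> be the intersection of the kernels. All open sets of the members of \<open>A\<close> are
  \<open>M\<close>-invariant, so the coarsening of \<open>S\<close> to its \<open>M\<close>-invariant open sets is still an upper bound
  of \<open>A\<close>. By minimality it is \<open>S\<close> itself, and so no neighbourhood of 0 separates 0 from \<open>M\<close>.\<close>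
lemma topology_kernel_sup:
  assumes A: "A \<subseteq> {T. vector_topology TK s T}"
    and S: "least (vector_topologies TK s) S (Upper (vector_topologies TK s) A)"
  shows "topology_kernel S = (\<Inter>T\<in>A. topology_kernel T)"
proof
  let ?L = "vector_topologies TK s"
  let ?M = "\<Inter>T\<in>A. topology_kernel T"
  have S': "vector_topology TK s S"
    using S unfolding least_def Upper_def by simp
  have upper: "openin S U" if "T \<in> A" "openin T U" for T U
  proof -
    have "S \<in> Upper ?L A"
      using S unfolding least_def by blast
    then have "le ?L T S"
      using that(1) A unfolding Upper_def by auto
    then show ?thesis
      using that(2) by simp
  qed
  have min: "openin R U"
    if R: "vector_topology TK s R" "\<And>T V. T \<in> A \<Longrightarrow> openin T V \<Longrightarrow> openin R V" and "openin S U" for R U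
  proof -
    have "R \<in> Upper ?L A"
      using R unfolding Upper_def by auto
    then have "le ?L S R"
      using S unfolding least_def by blast
    then show ?thesis
      using that(3) by simp
  qed
  show "topology_kernel S \<subseteq> ?M"
    using upper by (auto simp: topology_kernel_def)
  have M: "subspace ?M"
    using A subspace_topology_kernel by (intro subspace_Inter) auto
  obtain R where R: "vector_topology TK s R"
      "\<And>U. openin R U \<longleftrightarrow> openin S U \<and> (\<forall>u\<in>U. \<forall>m\<in>?M. u + m \<in> U)"
    using vector_topology_invariant_opens[OF S' M] by blast
  have "openin R U" if "T \<in> A" "openin T U" for T U
    unfolding R(2) using that upper openin_translate_kernel[of T U] A by auto
  then have "openin R U" if "openin S U" for U
    using min[OF R(1) _ that] by blast
  then show "?M \<subseteq> topology_kernel S"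
    unfolding R(2) topology_kernel_def[of S] by force
qed

lemma topology_kernel_join:
  assumes "vector_topology TK s S" "vector_topology TK s T"
  shows "vector_topology TK s (S \<squnion>\<^bsub>vector_topologies TK s\<^esub> T)"
    and "topology_kernel (S \<squnion>\<^bsub>vector_topologies TK s\<^esub> T) = topology_kernel S \<inter> topology_kernel T"
proof -
  let ?L = "vector_topologies TK s"
  have least: "least ?L (S \<squnion>\<^bsub>?L\<^esub> T) (Upper ?L {S, T})"
    unfolding join_def sup_def
    by (rule someI_ex) (rule sup_vector_topologies_exists, use assms topspace_field in auto)
  then show "vector_topology TK s (S \<squnion>\<^bsub>?L\<^esub> T)"
    by (auto simp: least_def Upper_def)
  show "topology_kernel (S \<squnion>\<^bsub>?L\<^esub> T) = topology_kernel S \<inter> topology_kernel T"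
    using topology_kernel_sup[OF _ least] assms by auto
qed

lemma vector_topology_pullback:
  assumes f: "Vector_Spaces.linear s (*) f"
  shows "vector_topology TK s (pullback_topology UNIV f TK)"
    and "topology_kernel (pullback_topology UNIV f TK) = {x. f x = 0}"
proof -
  interpret f: Vector_Spaces.linear s "(*)" f by fact
  have H: "Hausdorff_space TK"
    using topological_field by (simp add: topological_field_def)
  note prod_iff = continuous_map_prod_iff[OF topspace_field topspace_field topspace_field]
  have plus: "\<exists>A B. openin TK A \<and> openin TK B \<and> a \<in> A \<and> b \<in> B \<and> (\<forall>a\<in>A. \<forall>b\<in>B. a + b \<in> V)"
    if "openin TK V" "a + b \<in> V" for V a b
  proof -
    have "continuous_map (prod_topology TK TK) TK (\<lambda>(a, b). a + b)"
      using topological_field by (simp add: topological_field_def)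
    then show ?thesis
      using that unfolding prod_iff by simp
  qed
  have times: "\<exists>A B. openin TK A \<and> openin TK B \<and> a \<in> A \<and> b \<in> B \<and> (\<forall>a\<in>A. \<forall>b\<in>B. a * b \<in> V)"
    if "openin TK V" "a * b \<in> V" for V a b
  proof -
    have "continuous_map (prod_topology TK TK) TK (\<lambda>(a, b). a * b)"
      using topological_field by (simp add: topological_field_def)
    then show ?thesis
      using that unfolding prod_iff by simp
  qed
  have op: "openin (pullback_topology UNIV f TK) U \<longleftrightarrow> (\<exists>V. openin TK V \<and> U = f -` V)" for U
    by (simp add: openin_pullback_topology)
  show "vector_topology TK s (pullback_topology UNIV f TK)"
    unfolding vector_topology_iff
  proof (intro conjI allI impI)
    show "topspace (pullback_topology UNIV f TK) = UNIV"
      by (simp add: topspace_pullback_topology topspace_field)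
  next
    fix U x y assume "openin (pullback_topology UNIV f TK) U \<and> x + y \<in> U"
    then obtain V where V: "openin TK V" "U = f -` V" "f x + f y \<in> V"
      by (auto simp: op f.add)
    obtain A B where "openin TK A" "openin TK B" "f x \<in> A" "f y \<in> B" "\<forall>a\<in>A. \<forall>b\<in>B. a + b \<in> V"
      using plus[OF V(1,3)] by blast
    then show "\<exists>A B. openin (pullback_topology UNIV f TK) A \<and> openin (pullback_topology UNIV f TK) B \<and>
        x \<in> A \<and> y \<in> B \<and> (\<forall>a\<in>A. \<forall>b\<in>B. a + b \<in> U)"
      unfolding op by (intro exI[of _ "f -` A"] exI[of _ "f -` B"]) (auto simp: V(2) f.add)
  next
    fix U c x assume "openin (pullback_topology UNIV f TK) U \<and> s c x \<in> U"
    then obtain V where V: "openin TK V" "U = f -` V" "c * f x \<in> V"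
      by (auto simp: op f.scale)
    obtain A B where "openin TK A" "openin TK B" "c \<in> A" "f x \<in> B" "\<forall>a\<in>A. \<forall>b\<in>B. a * b \<in> V"
      using times[OF V(1,3)] by blast
    then show "\<exists>A B. openin TK A \<and> openin (pullback_topology UNIV f TK) B \<and>
        c \<in> A \<and> x \<in> B \<and> (\<forall>a\<in>A. \<forall>b\<in>B. s a b \<in> U)"
      unfolding op by (intro exI[of _ "A"] exI[of _ "f -` B"]) (auto simp: V(2) f.scale)
  qed
  have "f x = 0" if x: "x \<in> topology_kernel (pullback_topology UNIV f TK)" for x
  proof (rule ccontr)
    assume "f x \<noteq> 0"
    then obtain U V where UV: "openin TK U" "0 \<in> U" "f x \<in> V" "disjnt U V"
      using H topspace_field unfolding Hausdorff_space_def by (metis UNIV_I)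
    then have "x \<in> f -` U"
      using x f.zero unfolding topology_kernel_def op by blast
    then show False
      using UV by (auto simp: disjnt_iff)
  qed
  moreover have "x \<in> topology_kernel (pullback_topology UNIV f TK)" if "f x = 0" for x
    using that f.zero by (auto simp: topology_kernel_def op)
  ultimately show "topology_kernel (pullback_topology UNIV f TK) = {x. f x = 0}"
    by blast
qed

lemma exists_separating_functional:
  assumes M: "subspace M" and x: "x \<notin> M"
  shows "\<exists>f. Vector_Spaces.linear s (*) f \<and> (\<forall>m\<in>M. f m = 0) \<and> f x \<noteq> 0"
proof -
  interpret K: vector_space "(*) :: 'k \<Rightarrow> 'k \<Rightarrow> 'k"
    by unfold_locales (auto simp: algebra_simps)
  interpret pair: vector_space_pair s "(*) :: 'k \<Rightarrow> 'k \<Rightarrow> 'k" ..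
  obtain B where B: "B \<subseteq> M" "independent B" "M \<subseteq> span B"
    using maximal_independent_subset by blast
  have x': "x \<notin> span B"
    using x span_minimal[OF B(1) M] by blast
  obtain f where f: "Vector_Spaces.linear s (*) f" "\<forall>b\<in>insert x B. f b = (if b = x then 1 else 0)"
    using pair.linear_independent_extend[OF independent_insertI[OF x' B(2)], of "\<lambda>b. if b = x then 1 else 0"]
    by blast
  have "f b = 0" if "b \<in> B" for b
    using that f(2) x' span_base by auto
  then have "f m = 0" if "m \<in> M" for m
    using pair.linear_eq_0_on_span[OF f(1)] that B(3) by blast
  then show ?thesis
    using f by auto
qed

text \<open>The weak topology of all linear functionals that vanish on \<open>M\<close>: since the field is Hausdorff,
  a functional contributes its own kernel, and a subspace is the intersection of the kernels of the
  functionals that vanish on it.\<close>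
lemma exists_topology_with_kernel:
  assumes M: "subspace M"
  shows "\<exists>T. vector_topology TK s T \<and> topology_kernel T = M"
proof -
  let ?L = "vector_topologies TK s"
  define A where "A = {pullback_topology UNIV f TK |f. Vector_Spaces.linear s (*) f \<and> (\<forall>m\<in>M. f m = 0)}"
  have A: "A \<subseteq> {T. vector_topology TK s T}"
    using vector_topology_pullback(1) by (auto simp: A_def)
  then obtain S where S: "least ?L S (Upper ?L A)"
    using sup_vector_topologies_exists[OF topspace_field, of A] by auto
  then have "vector_topology TK s S"
    by (auto simp: least_def Upper_def)
  moreover have "topology_kernel S = M"
    unfolding topology_kernel_sup[OF A S]
    using exists_separating_functional[OF M] vector_topology_pullback(2)
    unfolding A_def by fastforce
  ultimately show ?thesis
    by blast
qed

text \<open>A vector \<open>x\<close> in the kernel of \<open>S\<close> but not in that of \<open>T\<close> spans a line, itself a kernel, that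
  meets the kernel of \<open>T\<close> trivially but not that of \<open>S\<close>. The point of the lemma is that its right-hand side
  mentions kernels only through trivial intersections.\<close>
lemma topology_kernel_subset_iff:
  assumes S: "vector_topology TK s S" and T: "vector_topology TK s T"
  shows "topology_kernel S \<subseteq> topology_kernel T \<longleftrightarrow>
    (\<forall>R. vector_topology TK s R \<and> topology_kernel R \<inter> topology_kernel T = {0} \<longrightarrow>
      topology_kernel R \<inter> topology_kernel S = {0})" (is "_ \<longleftrightarrow> ?disjoint")
proof
  assume "topology_kernel S \<subseteq> topology_kernel T"
  then show ?disjoint
    using zero_in_topology_kernel by blast
next
  assume D: ?disjoint
  show "topology_kernel S \<subseteq> topology_kernel T"
  proof (rule subsetI, rule ccontr)
    fix x assume x: "x \<in> topology_kernel S" "x \<notin> topology_kernel T"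
    obtain R where R: "vector_topology TK s R" "topology_kernel R = span {x}"
      using exists_topology_with_kernel[OF subspace_span] by blast
    have sub: "subspace (span {x} \<inter> topology_kernel T)"
      by (intro subspace_inter subspace_span subspace_topology_kernel T)
    have "x \<notin> span {x} \<inter> topology_kernel T"
      using x by simp
    then have "span {x} \<inter> topology_kernel T = {0}"
      using subspace_of_line[OF sub] span_base[of x "{x}"] by blast
    then have "span {x} \<inter> topology_kernel S = {0}"
      using D R by metis
    then have "x = 0"
      using x(1) span_base[of x "{x}"] by auto
    then show False
      using x(2) zero_in_topology_kernel by blast
  qed
qed

end

section \<open>From lattices of topologies to lattices of subspaces\<close>

theorem theoremC:
  fixes TK :: "'k::field topology" and TL :: "'l::field topology"
    and sX :: "'k \<Rightarrow> 'x::ab_group_add \<Rightarrow> 'x" and sY :: "'l \<Rightarrow> 'y::ab_group_add \<Rightarrow> 'y"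
  assumes "topological_field TK" and "topological_field TL"
    and "vector_space sX" and "vector_space sY"
    and "|{..<3::nat}| \<le>o vs_dim sX"
    and "\<exists>\<Phi>. lattice_isomorphism (vector_topologies TK sX) (vector_topologies TL sY) \<Phi> \<and>
           \<Phi> ` Hausdorff_vector_topologies TK sX = Hausdorff_vector_topologies TL sY"
  shows "(\<exists>f :: 'k \<Rightarrow> 'l. field_isomorphism f) \<and> vs_dim sX =o vs_dim sY"
proof -
  interpret X: vector_space sX by fact
  interpret Y: vector_space sY by fact
  interpret X: vector_space_over_topological_field sX TK
    by unfold_locales fact
  interpret Y: vector_space_over_topological_field sY TL
    by unfold_locales fact
  let ?X = "vector_topologies TK sX" and ?Y = "vector_topologies TL sY"
  obtain \<Phi> where bij: "bij_betw \<Phi> {T. vector_topology TK sX T} {T. vector_topology TL sY T}"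
    and join: "\<And>S T. vector_topology TK sX S \<Longrightarrow> vector_topology TK sX T \<Longrightarrow>
      \<Phi> (S \<squnion>\<^bsub>?X\<^esub> T) = \<Phi> S \<squnion>\<^bsub>?Y\<^esub> \<Phi> T"
    and haus: "\<Phi> ` Hausdorff_vector_topologies TK sX = Hausdorff_vector_topologies TL sY"
    using assms(6) by (auto simp: lattice_isomorphism_def join_pres_def)
  have \<Phi>: "vector_topology TL sY (\<Phi> T)" if "vector_topology TK sX T" for T
    using bij_betwE[OF bij] that by blast
  have surj: "\<exists>T. vector_topology TK sX T \<and> \<Phi> T = R" if "vector_topology TL sY R" for R
    using bij_betw_imp_surj_on[OF bij] that by (metis (no_types, lifting) imageE mem_Collect_eq)
  have Haus: "Hausdorff_space (\<Phi> T) \<longleftrightarrow> Hausdorff_space T" if T: "vector_topology TK sX T" for T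
  proof -
    have "\<Phi> T \<in> \<Phi> ` Hausdorff_vector_topologies TK sX \<longleftrightarrow> T \<in> Hausdorff_vector_topologies TK sX"
      using T by (intro inj_on_image_mem_iff[OF bij_betw_imp_inj_on[OF bij]])
        (auto simp: Hausdorff_vector_topologies_def)
    then show ?thesis
      unfolding haus using T \<Phi>[OF T] by (simp add: Hausdorff_vector_topologies_def)
  qed
  \<comment> \<open>Both sides say that the join of the two topologies is Hausdorff.\<close>
  have disjoint: "topology_kernel (\<Phi> S) \<inter> topology_kernel (\<Phi> T) = {0} \<longleftrightarrow>
      topology_kernel S \<inter> topology_kernel T = {0}"
    if ST: "vector_topology TK sX S" "vector_topology TK sX T" for S T
  proof -
    note XJ = X.topology_kernel_join[OF ST] and YJ = Y.topology_kernel_join[OF ST[THEN \<Phi>]]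
    have "topology_kernel S \<inter> topology_kernel T = {0} \<longleftrightarrow> Hausdorff_space (S \<squnion>\<^bsub>?X\<^esub> T)"
      by (simp only: X.Hausdorff_iff_topology_kernel[OF XJ(1)] XJ(2))
    also have "\<dots> \<longleftrightarrow> Hausdorff_space (\<Phi> S \<squnion>\<^bsub>?Y\<^esub> \<Phi> T)"
      by (simp only: Haus[OF XJ(1), symmetric] join[OF ST])
    also have "\<dots> \<longleftrightarrow> topology_kernel (\<Phi> S) \<inter> topology_kernel (\<Phi> T) = {0}"
      by (simp only: Y.Hausdorff_iff_topology_kernel[OF YJ(1)] YJ(2))
    finally show ?thesis ..
  qed
  have mono: "topology_kernel (\<Phi> S) \<subseteq> topology_kernel (\<Phi> T) \<longleftrightarrow> topology_kernel S \<subseteq> topology_kernel T"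
    if ST: "vector_topology TK sX S" "vector_topology TK sX T" for S T
    unfolding X.topology_kernel_subset_iff[OF ST] Y.topology_kernel_subset_iff[OF ST[THEN \<Phi>]]
    using surj \<Phi> disjoint ST by metis
  \<comment> \<open>By \<open>mono\<close>, the kernel of \<open>\<Phi> T\<close> depends only on the kernel of \<open>T\<close>; so the choice of a topology
    for each subspace is immaterial.\<close>
  obtain top where top: "\<And>M. X.subspace M \<Longrightarrow> vector_topology TK sX (top M)"
      "\<And>M. X.subspace M \<Longrightarrow> topology_kernel (top M) = M"
    using X.exists_topology_with_kernel by metis
  have "\<exists>g. span_preserving_map sX sY g"
  proof (rule span_preserving_map_of_subspace_isomorphism[where \<psi> = "\<lambda>M. topology_kernel (\<Phi> (top M))"])
    fix M M' assume M: "X.subspace M"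
    then show "Y.subspace (topology_kernel (\<Phi> (top M)))"
      by (intro Y.subspace_topology_kernel \<Phi> top)
    assume "X.subspace M'"
    then show "topology_kernel (\<Phi> (top M)) \<subseteq> topology_kernel (\<Phi> (top M')) \<longleftrightarrow> M \<subseteq> M'"
      using M mono top by metis
  next
    fix N assume "Y.subspace N"
    then obtain T where T: "vector_topology TK sX T" "topology_kernel (\<Phi> T) = N"
      using Y.exists_topology_with_kernel surj by metis
    have M: "X.subspace (topology_kernel T)"
      by (rule X.subspace_topology_kernel) fact
    have "topology_kernel (\<Phi> (top (topology_kernel T))) = N"
      using mono[OF T(1) top(1)[OF M]] mono[OF top(1)[OF M] T(1)] top(2)[OF M] T(2) by blast
    then show "\<exists>M. X.subspace M \<and> topology_kernel (\<Phi> (top M)) = N"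
      using M by blast
  qed fact+
  then obtain g where "span_preserving_map sX sY g" ..
  then interpret span_preserving_map sX sY g .
  obtain B where B: "X.independent B" "X.span B = UNIV"
    using X.exists_basis by blast
  have "|{..<3::nat}| \<le>o |B|"
    using assms(5) X.vs_dim_eq[OF B] by (rule ordLeq_ordIso_trans)
  then obtain e where e: "inj_on e {..<3::nat}" "e ` {..<3} \<subseteq> B"
    using card_of_ordLeq[of "{..<3::nat}" B] by blast
  have ind: "e i \<notin> X.span {e j, e k}" if "i < 3" "j < 3" "k < 3" "i \<noteq> j" "i \<noteq> k" for i j k
  proof -
    have "{e j, e k} \<subseteq> B - {e i}" "e i \<in> B"
      using e that by (auto simp: inj_on_def)
    then show ?thesis
      using B(1) X.span_mono[of "{e j, e k}" "B - {e i}"] by (auto simp: X.dependent_def)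
  qed
  show ?thesis
    using exists_field_isomorphism[of "e 0" "e 1" "e 2"] ind vs_dim_eq_vs_dim by simp
qed

end
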